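(* Let $b_\tau:\mathbb R^d\to\mathbb R^d$ and $\sigma_\tau:\mathbb R^d\to\mathbb R^{d\times m}$, $\tau\in(0,1]$, have at most linear growth, and suppose there exist positive constants $T_1,T_2$, independent of $\tau$, such that for all $x\in\mathbb R^d$ and $\tau\in(0,1]$, $$2\langle x,b_\tau(x)\rangle+\|\sigma_\tau(x)\|^2+\tau|b_\tau(x)|^2\le T_1-T_2|x|^2 .$$ Let $X_0$ be an $\mathscr F(0)$-measurable $\mathbb R^d$-valued random variable with $\mathbb E|X_0|^2<\infty$, and let $(Z_n)_{n\ge0}$ be generated by the tamed Euler--Maruyama scheme $$Z_n=Z_{n-1}+b_\tau(Z_{n-1})\tau+\sigma_\tau(Z_{n-1})\bigl(W(t_n)-W(t_{n-1})\bigr),\quad n\in\mathbb N_+;\qquad Z_0=X_0,$$ where $t_n:=n\tau$. Then there exists $\tau_{\max}\in(0,1]$ such that for any $\tau\in(0,\tau_{\max}]$, $$\mathbb E\bigl[|Z_n|^2\,\big|\,\mathscr F(t_{n-1})\bigr]\le(1-T_2\tau)|Z_{n-1}|^2+T_1\tau,\qquad n\in\mathbb N_+,$$ almost surely.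
   Context: $(\Omega,\mathscr F,(\mathscr F(t))_{t\ge0},\mathbb P)$ is a complete filtered probability space carrying an $\mathbb R^m$-valued Wiener process $W$ with respect to the filtration. $|\cdot|$ and $\langle\cdot,\cdot\rangle$ are the Euclidean norm and inner product, and $\|\cdot\|$ is the Hilbert--Schmidt norm on $\mathbb R^{d\times m}$. The scheme is a discretization of the SDE $dX(t)=b(X(t))\,dt+\sigma(X(t))\,dW(t)$ in $\mathbb R^d$; the functions $b_\tau,\sigma_\tau$ are assumed Borel measurable, to have at most linear growth for each $\tau$ (i.e. bounded by $c_\tau(1+|x|)$), and to converge to $b$ and $\sigma$ as $\tau\to0$. *)

theory Defs
  imports "HOL-Probability.Probability"
begin

text \<open>Time is \<open>[0, \<infinity>)\<close>, encoded as the nonnegative reals: \<open>F t\<close> and \<open>W t\<close> are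
  unconstrained for \<open>t < 0\<close>, which is why the locale \<open>filtration\<close> of the library is not used.
  Completeness is that of the measure \<open>M\<close>; null sets need not belong to \<open>F 0\<close>, and the
  filtration need not be right-continuous.\<close>

locale filtered_prob_space = prob_space M + complete_measure M
  for M :: "'w measure" +
  fixes F :: "real \<Rightarrow> 'w measure"
  assumes subalgebra_F: "\<And>t. 0 \<le> t \<Longrightarrow> subalgebra M (F t)"
    and sets_F_mono: "\<And>s t. 0 \<le> s \<Longrightarrow> s \<le> t \<Longrightarrow> sets (F s) \<subseteq> sets (F t)"

text \<open>The last two assumptions say that \<open>W t - W s\<close> has law \<open>N(0, (t - s) I)\<close>.\<close>

locale wiener_process = filtered_prob_space M F
  for M :: "'w measure" and F :: "real \<Rightarrow> 'w measure" +
  fixes W :: "real \<Rightarrow> 'w \<Rightarrow> real ^ 'm"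
  assumes W_zero: "AE \<omega> in M. W 0 \<omega> = 0"
    and W_continuous: "AE \<omega> in M. continuous_on {0..} (\<lambda>t. W t \<omega>)"
    and W_adapted: "\<And>t. 0 \<le> t \<Longrightarrow> W t \<in> borel_measurable (F t)"
    and W_increment_indep: "\<And>s t. 0 \<le> s \<Longrightarrow> s < t \<Longrightarrow>
      indep_set (sets (F s)) {(\<lambda>\<omega>. W t \<omega> - W s \<omega>) -` A \<inter> space M | A. A \<in> sets borel}"
    and W_increment_components_indep: "\<And>s t. 0 \<le> s \<Longrightarrow> s < t \<Longrightarrow>
      indep_vars (\<lambda>_. borel) (\<lambda>j \<omega>. (W t \<omega> - W s \<omega>) $ j) UNIV"
    and W_increment_components_normal: "\<And>s t j. 0 \<le> s \<Longrightarrow> s < t \<Longrightarrow>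
      distributed M lborel (\<lambda>\<omega>. (W t \<omega> - W s \<omega>) $ j) (normal_density 0 (sqrt (t - s)))"

definition linear_growth :: "('a::real_normed_vector \<Rightarrow> 'b::real_normed_vector) \<Rightarrow> bool" where
  "linear_growth f \<longleftrightarrow> (\<exists>c. \<forall>x. norm (f x) \<le> c * (1 + norm x))"

text \<open>The library norm on \<open>real ^ 'm ^ 'd\<close> is the Hilbert--Schmidt norm, not the operator norm.\<close>

lemma norm_matrix_hilbert_schmidt:
  fixes A :: "real ^ 'm ^ 'd"
  shows "(norm A)\<^sup>2 = (\<Sum>i\<in>UNIV. \<Sum>j\<in>UNIV. (A $ i $ j)\<^sup>2)"
  by (simp add: norm_vec_def L2_set_def sum_nonneg)

primrec tamed_euler_maruyama ::
  "(real \<Rightarrow> real ^ 'd \<Rightarrow> real ^ 'd) \<Rightarrow> (real \<Rightarrow> real ^ 'd \<Rightarrow> real ^ 'm ^ 'd) \<Rightarrow>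
    (real \<Rightarrow> 'w \<Rightarrow> real ^ 'm) \<Rightarrow> ('w \<Rightarrow> real ^ 'd) \<Rightarrow> real \<Rightarrow> nat \<Rightarrow> 'w \<Rightarrow> real ^ 'd" where
  "tamed_euler_maruyama bt \<sigma>t W X0 \<tau> 0 = X0"
| "tamed_euler_maruyama bt \<sigma>t W X0 \<tau> (Suc n) =
    (\<lambda>\<omega>. let z = tamed_euler_maruyama bt \<sigma>t W X0 \<tau> n \<omega> in
      z + \<tau> *\<^sub>R bt \<tau> z + \<sigma>t \<tau> z *v (W (real (Suc n) * \<tau>) \<omega> - W (real n * \<tau>) \<omega>))"

end

theory Submission
  imports Defs
begin

text \<open>One step of the scheme has the form \<open>u + S D\<close>, where
  \<open>u = Z\<^sub>n + \<tau> b\<^sub>\<tau>(Z\<^sub>n)\<close> and \<open>S = \<sigma>\<^sub>\<tau>(Z\<^sub>n)\<close> are known at time \<open>t\<^sub>n\<close>, while the Wiener increment \<open>D\<close> is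
  independent of the past, centred, and has covariance \<open>\<tau> I\<close>. On expanding \<open>|u + S D|\<^sup>2\<close> and conditioning,
  the term linear in \<open>D\<close> disappears and the quadratic one becomes \<open>\<tau>\<close> times the trace of \<open>S\<^sup>T S\<close>, so the
  conditional second moment is exactly \<open>|u|\<^sup>2 + \<tau> \<parallel>S\<parallel>\<^sup>2\<close>
  (\<open>real_cond_exp_norm_add_noise_squared\<close>). Expanding \<open>|u|\<^sup>2\<close> as well,
  this is \<open>|Z\<^sub>n|\<^sup>2\<close> plus \<open>\<tau>\<close> times precisely the left-hand side of the dissipativity condition
  at \<open>Z\<^sub>n\<close>, and the claim follows. The estimate therefore holds for every step size in \<open>(0, 1]\<close>,
  and \<open>\<tau>_max = 1\<close> serves as the threshold.

  The conditioning is legitimate because \<open>Z\<^sub>n\<close> is adapted and square integrable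
  (\<open>tamed_euler_maruyama_adapted_square_integrable\<close>). Square integrability passes from one step
  to the next: by linear growth \<open>u\<close> and \<open>S\<close> are square integrable with \<open>Z\<^sub>n\<close>, and
  products of their entries with monomials in \<open>D\<close> are integrable since independence makes the expectation
  of the absolute value factorize.\<close>

section \<open>Conditioning on a sub-sigma-algebra independent of a random variable\<close>

lemma Int_stable_preimages: "Int_stable {f -` A \<inter> \<Omega> | A. A \<in> sets N}"
proof (rule Int_stableI, clarify)
  fix A B assume "A \<in> sets N" "B \<in> sets N"
  then show "\<exists>C. f -` A \<inter> \<Omega> \<inter> (f -` B \<inter> \<Omega>) = f -` C \<inter> \<Omega> \<and> C \<in> sets N"
    by (intro exI[of _ "A \<inter> B"]) auto
qed

lemma (in prob_space) indep_var_of_indep_set: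
  fixes Y :: "'a \<Rightarrow> real" and D :: "'a \<Rightarrow> 'b::topological_space" and \<phi> :: "'b \<Rightarrow> real"
  assumes G: "subalgebra M G"
    and indep: "indep_set (sets G) {D -` A \<inter> space M | A. A \<in> sets borel}"
    and Y: "Y \<in> borel_measurable G"
    and D: "D \<in> borel_measurable M" and \<phi>: "\<phi> \<in> borel_measurable borel"
  shows "indep_var borel Y borel (\<lambda>\<omega>. \<phi> (D \<omega>))"
  unfolding indep_var_eq
proof (intro conjI indep_set_sigma_sets)
  show "random_variable borel Y"
    using measurable_from_subalg[OF G Y] .
  show "random_variable borel (\<lambda>\<omega>. \<phi> (D \<omega>))"
    using measurable_compose[OF D \<phi>] .
  have "{Y -` A \<inter> space M | A. A \<in> sets borel} \<subseteq> sets G"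
    using measurable_sets[OF Y] G by (auto simp: subalgebra_def)
  moreover have "{(\<lambda>\<omega>. \<phi> (D \<omega>)) -` A \<inter> space M | A. A \<in> sets borel}
      \<subseteq> {D -` A \<inter> space M | A. A \<in> sets borel}"
  proof safe
    fix A :: "real set" assume "A \<in> sets borel"
    then have "\<phi> -` A \<in> sets borel"
      using measurable_sets[OF \<phi>] by force
    then show "\<exists>B. (\<lambda>\<omega>. \<phi> (D \<omega>)) -` A \<inter> space M = D -` B \<inter> space M \<and> B \<in> sets borel"
      by (intro exI[of _ "\<phi> -` A"]) auto
  qed
  ultimately show "indep_set {Y -` A \<inter> space M | A. A \<in> sets borel}
      {(\<lambda>\<omega>. \<phi> (D \<omega>)) -` A \<inter> space M | A. A \<in> sets borel}"
    using indep unfolding indep_sets2_eq by (meson subset_trans subsetD)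
qed (rule Int_stable_preimages)+

text \<open>For an event \<open>A\<close> in \<open>G\<close>, the variable \<open>1\<^sub>A Y\<close> is again measurable with respect to \<open>G\<close>, hence independent of
  \<open>\<phi>(D)\<close>; the product formula for \<open>E[1\<^sub>A Y \<phi>(D)]\<close> says that the integrals
  of \<open>Y \<phi>(D)\<close> and \<open>Y E[\<phi>(D)]\<close> over \<open>A\<close> agree, which characterizes
  the conditional expectation. Integrability of the product also comes from independence.\<close>

lemma (in prob_space) real_cond_exp_mult_indep:
  fixes Y :: "'a \<Rightarrow> real" and D :: "'a \<Rightarrow> 'b::topological_space" and \<phi> :: "'b \<Rightarrow> real"
  assumes G: "subalgebra M G"
    and indep: "indep_set (sets G) {D -` A \<inter> space M | A. A \<in> sets borel}"
    and Y: "Y \<in> borel_measurable G" "integrable M Y"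
    and D: "D \<in> borel_measurable M" and \<phi>: "\<phi> \<in> borel_measurable borel"
    and int: "integrable M (\<lambda>\<omega>. \<phi> (D \<omega>))"
  shows "integrable M (\<lambda>\<omega>. Y \<omega> * \<phi> (D \<omega>))"
    and "AE \<omega> in M. real_cond_exp M G (\<lambda>\<omega>. Y \<omega> * \<phi> (D \<omega>)) \<omega> = Y \<omega> * expectation (\<lambda>\<omega>. \<phi> (D \<omega>))"
proof -
  interpret G: finite_measure_subalgebra M G
    using G by unfold_locales
  note iv = indep_var_of_indep_set[OF G indep _ D \<phi>]
  show int_prod: "integrable M (\<lambda>\<omega>. Y \<omega> * \<phi> (D \<omega>))"
    using indep_var_integrable[OF iv[OF Y(1)] Y(2) int] .
  show "AE \<omega> in M. real_cond_exp M G (\<lambda>\<omega>. Y \<omega> * \<phi> (D \<omega>)) \<omega> = Y \<omega> * expectation (\<lambda>\<omega>. \<phi> (D \<omega>))"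
  proof (rule G.real_cond_exp_charact)
    fix A assume A: "A \<in> sets G"
    then have A': "A \<in> sets M"
      using G by (auto simp: subalgebra_def)
    have YA: "(\<lambda>\<omega>. indicator A \<omega> * Y \<omega>) \<in> borel_measurable G"
      using A Y(1) by measurable
    have YA_int: "integrable M (\<lambda>\<omega>. indicator A \<omega> * Y \<omega>)"
      using integrable_mult_indicator[OF A' Y(2)] by simp
    have "expectation (\<lambda>\<omega>. indicator A \<omega> * Y \<omega> * \<phi> (D \<omega>))
        = expectation (\<lambda>\<omega>. indicator A \<omega> * Y \<omega>) * expectation (\<lambda>\<omega>. \<phi> (D \<omega>))"
      using indep_var_lebesgue_integral[OF iv[OF YA] YA_int int] .
    then show "(\<integral>\<omega>\<in>A. Y \<omega> * \<phi> (D \<omega>) \<partial>M)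
        = (\<integral>\<omega>\<in>A. Y \<omega> * expectation (\<lambda>\<omega>. \<phi> (D \<omega>)) \<partial>M)"
      by (simp add: set_lebesgue_integral_def mult.assoc[symmetric])
  qed (use int_prod Y in auto)
qed

lemma (in prob_space) real_cond_exp_sum_mult_indep:
  fixes Y :: "'i \<Rightarrow> 'a \<Rightarrow> real" and D :: "'a \<Rightarrow> 'b::topological_space" and \<phi> :: "'i \<Rightarrow> 'b \<Rightarrow> real"
  assumes G: "subalgebra M G"
    and indep: "indep_set (sets G) {D -` A \<inter> space M | A. A \<in> sets borel}"
    and Y: "\<And>i. Y i \<in> borel_measurable G" "\<And>i. integrable M (Y i)"
    and D: "D \<in> borel_measurable M" and \<phi>: "\<And>i. \<phi> i \<in> borel_measurable borel"
    and int: "\<And>i. integrable M (\<lambda>\<omega>. \<phi> i (D \<omega>))"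
    and fin: "finite I"
  shows "integrable M (\<lambda>\<omega>. \<Sum>i\<in>I. Y i \<omega> * \<phi> i (D \<omega>))"
    and "AE \<omega> in M. real_cond_exp M G (\<lambda>\<omega>. \<Sum>i\<in>I. Y i \<omega> * \<phi> i (D \<omega>)) \<omega>
      = (\<Sum>i\<in>I. Y i \<omega> * expectation (\<lambda>\<omega>. \<phi> i (D \<omega>)))"
proof -
  interpret G: finite_measure_subalgebra M G
    using G by unfold_locales
  note prod = real_cond_exp_mult_indep[OF G indep Y D \<phi> int]
  show "integrable M (\<lambda>\<omega>. \<Sum>i\<in>I. Y i \<omega> * \<phi> i (D \<omega>))"
    using prod(1) by simp
  have "AE \<omega> in M. \<forall>i\<in>I. real_cond_exp M G (\<lambda>\<omega>. Y i \<omega> * \<phi> i (D \<omega>)) \<omega>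
      = Y i \<omega> * expectation (\<lambda>\<omega>. \<phi> i (D \<omega>))"
    using prod(2) by (intro AE_finite_allI fin)
  with G.real_cond_exp_sum[of "\<lambda>i \<omega>. Y i \<omega> * \<phi> i (D \<omega>)" I, OF prod(1)]
  show "AE \<omega> in M. real_cond_exp M G (\<lambda>\<omega>. \<Sum>i\<in>I. Y i \<omega> * \<phi> i (D \<omega>)) \<omega>
      = (\<Sum>i\<in>I. Y i \<omega> * expectation (\<lambda>\<omega>. \<phi> i (D \<omega>)))"
    by eventually_elim simp
qed

section \<open>The conditional second moment of an affine function of centred noise\<close>

lemma norm_add_matrix_vector_mult_squared:
  fixes u :: "real ^ 'd" and S :: "real ^ 'm ^ 'd" and x :: "real ^ 'm"
  shows "(norm (u + S *v x))\<^sup>2 = (norm u)\<^sup>2 + (\<Sum>j\<in>UNIV. (2 * (\<Sum>i\<in>UNIV. u $ i * S $ i $ j)) * x $ j)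
    + (\<Sum>(j, k)\<in>UNIV. (\<Sum>i\<in>UNIV. S $ i $ j * S $ i $ k) * (x $ j * x $ k))"
proof -
  have "(norm (u + S *v x))\<^sup>2 = (norm u)\<^sup>2 + 2 * (u \<bullet> (S *v x)) + (S *v x) \<bullet> (S *v x)"
    by (simp add: power2_norm_eq_inner inner_add_left inner_add_right inner_commute)
  moreover have "2 * (u \<bullet> (S *v x)) = (\<Sum>j\<in>UNIV. (2 * (\<Sum>i\<in>UNIV. u $ i * S $ i $ j)) * x $ j)"
    unfolding inner_vec_def matrix_vector_mult_def
    by (simp add: sum_distrib_left sum_distrib_right mult.assoc) (rule sum.swap)
  moreover have "(S *v x) \<bullet> (S *v x)
      = (\<Sum>(j, k)\<in>UNIV. (\<Sum>i\<in>UNIV. S $ i $ j * S $ i $ k) * (x $ j * x $ k))"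
  proof -
    have "(S *v x) \<bullet> (S *v x)
        = (\<Sum>i\<in>UNIV. \<Sum>j\<in>UNIV. \<Sum>k\<in>UNIV. S $ i $ j * S $ i $ k * (x $ j * x $ k))"
      unfolding inner_vec_def matrix_vector_mult_def
      by (simp add: sum_product mult_ac)
    also have "\<dots> = (\<Sum>i\<in>UNIV. \<Sum>(j, k)\<in>UNIV. S $ i $ j * S $ i $ k * (x $ j * x $ k))"
      by (simp add: sum.cartesian_product)
    also have "\<dots> = (\<Sum>p\<in>UNIV. \<Sum>i\<in>UNIV. case p of (j, k) \<Rightarrow> S $ i $ j * S $ i $ k * (x $ j * x $ k))"
      by (rule sum.swap)
    finally show ?thesis
      by (simp add: sum_distrib_right case_prod_unfold)
  qed
  ultimately show ?thesis by simp
qed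

lemma borel_measurable_vec_component:
  fixes f :: "'a \<Rightarrow> ('b::real_normed_vector) ^ 'n"
  assumes "f \<in> borel_measurable N"
  shows "(\<lambda>x. f x $ i) \<in> borel_measurable N"
  by (rule measurable_compose[OF assms])
    (intro borel_measurable_continuous_onI continuous_intros)

text \<open>The conditional form of the bias-variance identity. The squared norm is a polynomial
  of degree two in the entries of \<open>D\<close> with coefficients measurable with respect to \<open>G\<close>, so the product rule above
  replaces each monomial by its expectation.\<close>

lemma (in prob_space) real_cond_exp_norm_add_noise_squared:
  fixes u :: "'a \<Rightarrow> real ^ 'd" and S :: "'a \<Rightarrow> real ^ 'm ^ 'd" and D :: "'a \<Rightarrow> real ^ 'm"
  assumes G: "subalgebra M G"
    and indep: "indep_set (sets G) {D -` A \<inter> space M | A. A \<in> sets borel}"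
    and u: "u \<in> borel_measurable G" "integrable M (\<lambda>\<omega>. (norm (u \<omega>))\<^sup>2)"
    and S: "S \<in> borel_measurable G" "integrable M (\<lambda>\<omega>. (norm (S \<omega>))\<^sup>2)"
    and D: "D \<in> borel_measurable M"
    and first: "\<And>j. integrable M (\<lambda>\<omega>. D \<omega> $ j)" "\<And>j. expectation (\<lambda>\<omega>. D \<omega> $ j) = 0"
    and second: "\<And>j k. integrable M (\<lambda>\<omega>. D \<omega> $ j * D \<omega> $ k)"
      "\<And>j k. expectation (\<lambda>\<omega>. D \<omega> $ j * D \<omega> $ k) = (if j = k then v else 0)"
  shows "integrable M (\<lambda>\<omega>. (norm (u \<omega> + S \<omega> *v D \<omega>))\<^sup>2)"
    and "AE \<omega> in M. real_cond_exp M G (\<lambda>\<omega>. (norm (u \<omega> + S \<omega> *v D \<omega>))\<^sup>2) \<omega>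
      = (norm (u \<omega>))\<^sup>2 + v * (norm (S \<omega>))\<^sup>2"
proof -
  interpret G: finite_measure_subalgebra M G
    using G by unfold_locales
  \<comment> \<open>The coefficients of the polynomial \<open>|u + S D|\<^sup>2\<close> in the entries of \<open>D\<close>: \<open>L = 2 S\<^sup>T u\<close> and
    \<open>Q = S\<^sup>T S\<close>.\<close>
  define L where "L j \<omega> = 2 * (\<Sum>i\<in>UNIV. u \<omega> $ i * S \<omega> $ i $ j)" for j \<omega>
  define Q where "Q = (\<lambda>(j, k) \<omega>. \<Sum>i\<in>UNIV. S \<omega> $ i $ j * S \<omega> $ i $ k)"
  define lin where "lin \<omega> = (\<Sum>j\<in>UNIV. L j \<omega> * D \<omega> $ j)" for \<omega>
  define quad where "quad \<omega> = (\<Sum>p\<in>UNIV. Q p \<omega> * (D \<omega> $ fst p * D \<omega> $ snd p))" for \<omega>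
  have expand: "(norm (u \<omega> + S \<omega> *v D \<omega>))\<^sup>2 = (norm (u \<omega>))\<^sup>2 + lin \<omega> + quad \<omega>" for \<omega>
    unfolding norm_add_matrix_vector_mult_squared lin_def quad_def L_def Q_def
    by (simp add: case_prod_unfold)
  have [measurable]: "(\<lambda>\<omega>. u \<omega> $ i) \<in> borel_measurable G" for i
    by (rule borel_measurable_vec_component[OF u(1)])
  have [measurable]: "(\<lambda>\<omega>. S \<omega> $ i $ j) \<in> borel_measurable G" for i j
    by (intro borel_measurable_vec_component S(1))
  have [measurable]: "(\<lambda>\<omega>. u \<omega> $ i) \<in> borel_measurable M" "(\<lambda>\<omega>. S \<omega> $ i $ j) \<in> borel_measurable M" for i j
    by (rule measurable_from_subalg[OF G], measurable)+
  have S_entry: "\<bar>S \<omega> $ i $ j\<bar> \<le> norm (S \<omega>)" for \<omega> i j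
    by (metis Finite_Cartesian_Product.norm_nth_le component_le_norm_cart order_trans)
  have int_uS: "integrable M (\<lambda>\<omega>. u \<omega> $ i * S \<omega> $ i $ j)" for i j
  proof (rule Bochner_Integration.integrable_bound[OF Bochner_Integration.integrable_add[OF u(2) S(2)]])
    show "AE \<omega> in M. norm (u \<omega> $ i * S \<omega> $ i $ j) \<le> norm ((norm (u \<omega>))\<^sup>2 + (norm (S \<omega>))\<^sup>2)"
    proof (rule AE_I2)
      fix \<omega>
      have "\<bar>u \<omega> $ i\<bar> * \<bar>S \<omega> $ i $ j\<bar> \<le> norm (u \<omega>) * norm (S \<omega>)"
        by (intro mult_mono component_le_norm_cart S_entry) auto
      also have "\<dots> \<le> (norm (u \<omega>))\<^sup>2 + (norm (S \<omega>))\<^sup>2"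
        using sum_squares_bound[of "norm (u \<omega>)" "norm (S \<omega>)"]
          mult_nonneg_nonneg[OF norm_ge_zero[of "u \<omega>"] norm_ge_zero[of "S \<omega>"]] by linarith
      finally show "norm (u \<omega> $ i * S \<omega> $ i $ j) \<le> norm ((norm (u \<omega>))\<^sup>2 + (norm (S \<omega>))\<^sup>2)"
        by (simp add: abs_mult)
    qed
  qed measurable
  have int_SS: "integrable M (\<lambda>\<omega>. S \<omega> $ i $ j * S \<omega> $ i $ k)" for i j k
  proof (rule Bochner_Integration.integrable_bound[OF S(2)])
    show "AE \<omega> in M. norm (S \<omega> $ i $ j * S \<omega> $ i $ k) \<le> norm ((norm (S \<omega>))\<^sup>2)"
      by (auto simp: abs_mult power2_eq_square intro!: mult_mono S_entry)
  qed measurable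
  have L: "L j \<in> borel_measurable G" "integrable M (L j)" for j
    unfolding L_def using int_uS by (measurable, simp)
  have Q: "Q p \<in> borel_measurable G" "integrable M (Q p)" for p
    unfolding Q_def case_prod_unfold using int_SS by (measurable, simp)
  have proj: "(\<lambda>x. x $ j) \<in> borel_measurable (borel :: (real ^ 'm) measure)" for j
    by (rule borel_measurable_vec_component) simp
  have proj2: "(\<lambda>x. x $ j * x $ k) \<in> borel_measurable (borel :: (real ^ 'm) measure)" for j k
    by (intro borel_measurable_times proj)
  have lin: "integrable M lin" "AE \<omega> in M. real_cond_exp M G lin \<omega> = 0"
    using real_cond_exp_sum_mult_indep[OF G indep L D proj first(1) finite]
    by (simp_all add: lin_def[abs_def] first(2))
  have quad: "integrable M quad" "AE \<omega> in M. real_cond_exp M G quad \<omega> = v * (norm (S \<omega>))\<^sup>2"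
  proof -
    \<comment> \<open>Only the diagonal of \<open>S\<^sup>T S\<close> survives, and its trace is the squared Hilbert--Schmidt norm.\<close>
    have trace: "(\<Sum>p\<in>UNIV. Q p \<omega> * (if fst p = snd p then v else 0)) = v * (norm (S \<omega>))\<^sup>2" for \<omega>
    proof -
      have "(\<Sum>p\<in>UNIV. Q p \<omega> * (if fst p = snd p then v else 0))
          = (\<Sum>j\<in>UNIV. \<Sum>k\<in>UNIV. Q (j, k) \<omega> * (if j = k then v else 0))"
        by (simp add: sum.cartesian_product case_prod_unfold)
      also have "\<dots> = (\<Sum>j\<in>UNIV. Q (j, j) \<omega> * v)"
        by (simp add: if_distrib[of "\<lambda>z. _ * z"] cong: if_cong)
      also have "\<dots> = v * (\<Sum>j\<in>UNIV. \<Sum>i\<in>UNIV. (S \<omega> $ i $ j)\<^sup>2)"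
        by (simp add: Q_def sum_distrib_left sum_distrib_right power2_eq_square mult_ac)
      also have "\<dots> = v * (norm (S \<omega>))\<^sup>2"
        unfolding norm_matrix_hilbert_schmidt by (subst sum.swap) rule
      finally show ?thesis .
    qed
    show "integrable M quad" "AE \<omega> in M. real_cond_exp M G quad \<omega> = v * (norm (S \<omega>))\<^sup>2"
      using real_cond_exp_sum_mult_indep[where Y = Q and \<phi> = "\<lambda>p x. x $ fst p * x $ snd p" and I = UNIV,
          OF G indep Q D proj2 second(1) finite]
      by (simp_all add: quad_def[abs_def] second(2) trace)
  qed
  show "integrable M (\<lambda>\<omega>. (norm (u \<omega> + S \<omega> *v D \<omega>))\<^sup>2)"
    unfolding expand using u(2) lin(1) quad(1) by simp
  have "(\<lambda>\<omega>. (norm (u \<omega>))\<^sup>2) \<in> borel_measurable G"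
    using u(1) by measurable
  note G.real_cond_exp_F_meas[OF u(2) this]
    G.real_cond_exp_add[OF Bochner_Integration.integrable_add[OF u(2) lin(1)] quad(1)]
    G.real_cond_exp_add[OF u(2) lin(1)] lin(2) quad(2)
  then show "AE \<omega> in M. real_cond_exp M G (\<lambda>\<omega>. (norm (u \<omega> + S \<omega> *v D \<omega>))\<^sup>2) \<omega>
      = (norm (u \<omega>))\<^sup>2 + v * (norm (S \<omega>))\<^sup>2"
    unfolding expand by eventually_elim simp
qed

section \<open>Moments of Wiener increments\<close>

context wiener_process
begin

lemma random_variable_W: "0 \<le> t \<Longrightarrow> random_variable borel (W t)"
  using measurable_from_subalg[OF subalgebra_F W_adapted] by simp

lemma W_increment_first_moment:
  assumes "0 \<le> s" "s < t"
  shows "integrable M (\<lambda>\<omega>. (W t \<omega> - W s \<omega>) $ j)"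
    and "expectation (\<lambda>\<omega>. (W t \<omega> - W s \<omega>) $ j) = 0"
proof -
  note N = W_increment_components_normal[OF assms, of j]
  have sd: "0 < sqrt (t - s)" using assms by simp
  show "integrable M (\<lambda>\<omega>. (W t \<omega> - W s \<omega>) $ j)"
    using distributed_integrable[OF N, of "\<lambda>x. x"] integrable_normal_moment_nz_1[OF sd, of 0] by simp
  show "expectation (\<lambda>\<omega>. (W t \<omega> - W s \<omega>) $ j) = 0"
    using distributed_integral[OF N, of "\<lambda>x. x"] integral_normal_moment_nz_1[OF sd, of 0] by simp
qed

lemma W_increment_second_moment:
  assumes "0 \<le> s" "s < t"
  defines "D \<equiv> \<lambda>\<omega>. W t \<omega> - W s \<omega>"
  shows "integrable M (\<lambda>\<omega>. D \<omega> $ j * D \<omega> $ k)"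
    and "expectation (\<lambda>\<omega>. D \<omega> $ j * D \<omega> $ k) = (if j = k then t - s else 0)"
proof -
  note N = W_increment_components_normal[OF assms(1,2)]
  have sd: "0 < sqrt (t - s)" using assms by simp
  have diag: "integrable M (\<lambda>\<omega>. D \<omega> $ j * D \<omega> $ j) \<and> expectation (\<lambda>\<omega>. D \<omega> $ j * D \<omega> $ j) = t - s"
  proof
    show "integrable M (\<lambda>\<omega>. D \<omega> $ j * D \<omega> $ j)"
      using distributed_integrable[OF N, of "\<lambda>x. x * x" j] integrable_normal_moment[OF sd, of 0 2]
      by (simp add: power2_eq_square D_def)
    show "expectation (\<lambda>\<omega>. D \<omega> $ j * D \<omega> $ j) = t - s"
      using distributed_integral[OF N, of "\<lambda>x. x * x" j] integral_normal_moment_even[OF sd, of 0 1] assms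
      by (simp add: power2_eq_square fact_numeral D_def)
  qed
  have off: "integrable M (\<lambda>\<omega>. D \<omega> $ j * D \<omega> $ k) \<and> expectation (\<lambda>\<omega>. D \<omega> $ j * D \<omega> $ k) = 0"
    if "j \<noteq> k"
  proof -
    have ind: "indep_vars (\<lambda>_. borel) (\<lambda>i \<omega>. (W t \<omega> - W s \<omega>) $ i) {j, k}"
      using W_increment_components_indep[OF assms(1,2)] by (rule indep_vars_subset) simp
    note first = W_increment_first_moment[OF assms(1,2)]
    show ?thesis
      using indep_vars_integrable[OF _ ind first(1)] indep_vars_lebesgue_integral[OF _ ind first(1)]
        first(2) that by (simp add: D_def)
  qed
  show "integrable M (\<lambda>\<omega>. D \<omega> $ j * D \<omega> $ k)"
    "expectation (\<lambda>\<omega>. D \<omega> $ j * D \<omega> $ k) = (if j = k then t - s else 0)"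
    using diag off by (cases "j = k"; simp)+
qed

lemma real_cond_exp_norm_add_W_increment_squared:
  fixes u :: "'w \<Rightarrow> real ^ 'd" and S :: "'w \<Rightarrow> real ^ 'm ^ 'd"
  assumes st: "0 \<le> s" "s < t"
    and u: "u \<in> borel_measurable (F s)" "integrable M (\<lambda>\<omega>. (norm (u \<omega>))\<^sup>2)"
    and S: "S \<in> borel_measurable (F s)" "integrable M (\<lambda>\<omega>. (norm (S \<omega>))\<^sup>2)"
  shows "integrable M (\<lambda>\<omega>. (norm (u \<omega> + S \<omega> *v (W t \<omega> - W s \<omega>)))\<^sup>2)"
    and "AE \<omega> in M. real_cond_exp M (F s) (\<lambda>\<omega>. (norm (u \<omega> + S \<omega> *v (W t \<omega> - W s \<omega>)))\<^sup>2) \<omega>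
      = (norm (u \<omega>))\<^sup>2 + (t - s) * (norm (S \<omega>))\<^sup>2"
proof -
  have D: "random_variable borel (\<lambda>\<omega>. W t \<omega> - W s \<omega>)"
    using random_variable_W st by (intro borel_measurable_diff) auto
  note square = real_cond_exp_norm_add_noise_squared[OF subalgebra_F[OF st(1)] W_increment_indep[OF st]
      u S D W_increment_first_moment[OF st] W_increment_second_moment[OF st]]
  show "integrable M (\<lambda>\<omega>. (norm (u \<omega> + S \<omega> *v (W t \<omega> - W s \<omega>)))\<^sup>2)"
    by (rule square(1))
  show "AE \<omega> in M. real_cond_exp M (F s) (\<lambda>\<omega>. (norm (u \<omega> + S \<omega> *v (W t \<omega> - W s \<omega>)))\<^sup>2) \<omega>
      = (norm (u \<omega>))\<^sup>2 + (t - s) * (norm (S \<omega>))\<^sup>2"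
    by (rule square(2))
qed

end

section \<open>Adaptedness and square integrability of the scheme\<close>

lemma (in finite_measure) linear_growth_square_integrable:
  fixes f :: "'b::euclidean_space \<Rightarrow> 'c::euclidean_space"
  assumes growth: "linear_growth f" and f: "f \<in> borel_measurable borel"
    and z: "z \<in> borel_measurable M" "integrable M (\<lambda>\<omega>. (norm (z \<omega>))\<^sup>2)"
  shows "integrable M (\<lambda>\<omega>. (norm (f (z \<omega>)))\<^sup>2)"
proof -
  obtain c where c: "\<And>x. norm (f x) \<le> c * (1 + norm x)"
    using growth unfolding linear_growth_def by blast
  have bound: "(norm (f x))\<^sup>2 \<le> c\<^sup>2 * (2 * (1 + (norm x)\<^sup>2))" for x
  proof -
    have "(norm (f x))\<^sup>2 \<le> (c * (1 + norm x))\<^sup>2"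
      by (intro power_mono c) simp
    also have "\<dots> \<le> c\<^sup>2 * (2 * (1 + (norm x)\<^sup>2))"
      using sum_squares_bound[of 1 "norm x"]
      by (subst power_mult_distrib, intro mult_left_mono) (auto simp: power2_sum)
    finally show ?thesis .
  qed
  have "integrable M (\<lambda>\<omega>. c\<^sup>2 * (2 * (1 + (norm (z \<omega>))\<^sup>2)))"
    using z(2) by simp
  then show ?thesis
  proof (rule Bochner_Integration.integrable_bound)
    show "(\<lambda>\<omega>. (norm (f (z \<omega>)))\<^sup>2) \<in> borel_measurable M"
      using measurable_compose[OF z(1) f] by measurable
    show "AE \<omega> in M. norm ((norm (f (z \<omega>)))\<^sup>2) \<le> norm (c\<^sup>2 * (2 * (1 + (norm (z \<omega>))\<^sup>2)))"
      using bound by (intro AE_I2) (simp add: abs_of_nonneg)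
  qed
qed

lemma borel_measurable_matrix_vector_mult:
  fixes S :: "'a \<Rightarrow> real ^ 'm ^ 'd" and x :: "'a \<Rightarrow> real ^ 'm"
  assumes S: "S \<in> borel_measurable N" and x: "x \<in> borel_measurable N"
  shows "(\<lambda>\<omega>. S \<omega> *v x \<omega>) \<in> borel_measurable N"
proof (rule borel_measurable_continuous_Pair[OF S x])
  show "continuous_on UNIV (\<lambda>p :: (real ^ 'm ^ 'd) \<times> (real ^ 'm). fst p *v snd p)"
    unfolding matrix_vector_mult_def by (intro continuous_intros)
qed

lemma (in filtered_prob_space) borel_measurable_F_mono:
  assumes "0 \<le> s" "s \<le> t" "f \<in> borel_measurable (F s)"
  shows "f \<in> borel_measurable (F t)"
  using assms subalgebra_F[of s] subalgebra_F[of t] sets_F_mono[of s t]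
  by (intro measurable_from_subalg[of "F t" "F s"]) (auto simp: subalgebra_def)

context wiener_process
begin

text \<open>Adaptedness and square integrability at time \<open>n\<close> are the hypotheses under which the second
  moment of step \<open>n + 1\<close> can be computed, and that computation in turn returns square
  integrability at time \<open>n + 1\<close>; hence both conclusions come from one induction.\<close>

lemma tamed_euler_maruyama_adapted_square_integrable:
  fixes bt :: "real \<Rightarrow> real ^ 'd \<Rightarrow> real ^ 'd" and \<sigma>t :: "real \<Rightarrow> real ^ 'd \<Rightarrow> real ^ 'm ^ 'd"
  assumes \<tau>: "0 < \<tau>"
    and b: "bt \<tau> \<in> borel_measurable borel" "linear_growth (bt \<tau>)"
    and \<sigma>: "\<sigma>t \<tau> \<in> borel_measurable borel" "linear_growth (\<sigma>t \<tau>)"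
    and X0: "X0 \<in> borel_measurable (F 0)" "integrable M (\<lambda>\<omega>. (norm (X0 \<omega>))\<^sup>2)"
  defines "Z \<equiv> tamed_euler_maruyama bt \<sigma>t W X0 \<tau>"
  shows "Z n \<in> borel_measurable (F (real n * \<tau>)) \<and> integrable M (\<lambda>\<omega>. (norm (Z n \<omega>))\<^sup>2)"
    (is "?adapted n \<and> ?sq n")
    and "AE \<omega> in M. real_cond_exp M (F (real n * \<tau>)) (\<lambda>\<omega>. (norm (Z (Suc n) \<omega>))\<^sup>2) \<omega>
      = (norm (Z n \<omega> + \<tau> *\<^sub>R bt \<tau> (Z n \<omega>)))\<^sup>2 + \<tau> * (norm (\<sigma>t \<tau> (Z n \<omega>)))\<^sup>2"
proof -
  have step: "?adapted (Suc n) \<and> ?sq (Suc n) \<and>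
      (AE \<omega> in M. real_cond_exp M (F (real n * \<tau>)) (\<lambda>\<omega>. (norm (Z (Suc n) \<omega>))\<^sup>2) \<omega>
        = (norm (Z n \<omega> + \<tau> *\<^sub>R bt \<tau> (Z n \<omega>)))\<^sup>2 + \<tau> * (norm (\<sigma>t \<tau> (Z n \<omega>)))\<^sup>2)"
    if n: "?adapted n" "?sq n" for n
  proof -
    let ?s = "real n * \<tau>" and ?t = "real (Suc n) * \<tau>"
    let ?u = "\<lambda>\<omega>. Z n \<omega> + \<tau> *\<^sub>R bt \<tau> (Z n \<omega>)" and ?S = "\<lambda>\<omega>. \<sigma>t \<tau> (Z n \<omega>)"
    have st: "0 \<le> ?s" "?s < ?t" "?t - ?s = \<tau>"
      using \<tau> by (auto simp: algebra_simps)
    have Zn: "random_variable borel (Z n)"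
      using measurable_from_subalg[OF subalgebra_F[OF st(1)] n(1)] .
    have u: "?u \<in> borel_measurable (F ?s)"
      using n(1) measurable_compose[OF n(1) b(1)] by measurable
    have S: "?S \<in> borel_measurable (F ?s)"
      using measurable_compose[OF n(1) \<sigma>(1)] .
    have "linear_growth (\<lambda>x. x + \<tau> *\<^sub>R bt \<tau> x)"
    proof -
      obtain c where c: "\<And>x. norm (bt \<tau> x) \<le> c * (1 + norm x)"
        using b(2) unfolding linear_growth_def by blast
      have "norm (x + \<tau> *\<^sub>R bt \<tau> x) \<le> (1 + \<tau> * c) * (1 + norm x)" for x
      proof -
        have "norm (x + \<tau> *\<^sub>R bt \<tau> x) \<le> norm x + \<tau> * norm (bt \<tau> x)"
          using norm_triangle_ineq[of x "\<tau> *\<^sub>R bt \<tau> x"] \<tau> by simp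
        also have "\<dots> \<le> norm x + \<tau> * (c * (1 + norm x))"
          using c[of x] \<tau> by (intro add_left_mono mult_left_mono) auto
        finally show ?thesis by (simp add: algebra_simps)
      qed
      then show ?thesis unfolding linear_growth_def by blast
    qed
    moreover have "(\<lambda>x. x + \<tau> *\<^sub>R bt \<tau> x) \<in> borel_measurable borel"
      using b(1) by measurable
    ultimately have u_sq: "integrable M (\<lambda>\<omega>. (norm (?u \<omega>))\<^sup>2)"
      by (rule linear_growth_square_integrable) (use Zn n(2) in auto)
    have S_sq: "integrable M (\<lambda>\<omega>. (norm (?S \<omega>))\<^sup>2)"
      by (rule linear_growth_square_integrable[OF \<sigma>(2,1) Zn n(2)])
    have Z_Suc: "Z (Suc n) = (\<lambda>\<omega>. ?u \<omega> + ?S \<omega> *v (W ?t \<omega> - W ?s \<omega>))"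
      unfolding Z_def by (simp add: Let_def)
    have "?adapted (Suc n)"
      unfolding Z_Suc using st(1,2)
      by (intro borel_measurable_add borel_measurable_matrix_vector_mult borel_measurable_diff
          borel_measurable_F_mono[of ?s ?t, OF _ _ u] borel_measurable_F_mono[of ?s ?t, OF _ _ S]
          borel_measurable_F_mono[of ?s ?t, OF _ _ W_adapted] W_adapted) linarith+
    then show ?thesis
      using real_cond_exp_norm_add_W_increment_squared[OF st(1,2) u u_sq S S_sq]
      unfolding st(3) Z_Suc by blast
  qed
  have ok: "?adapted n \<and> ?sq n" for n
    by (induction n) (use X0 step in \<open>auto simp: Z_def\<close>)
  show "?adapted n \<and> ?sq n"
    by (rule ok)
  show "AE \<omega> in M. real_cond_exp M (F (real n * \<tau>)) (\<lambda>\<omega>. (norm (Z (Suc n) \<omega>))\<^sup>2) \<omega>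
      = (norm (Z n \<omega> + \<tau> *\<^sub>R bt \<tau> (Z n \<omega>)))\<^sup>2 + \<tau> * (norm (\<sigma>t \<tau> (Z n \<omega>)))\<^sup>2"
    using step ok by blast
qed

end

section \<open>The one-step Lyapunov estimate\<close>

theorem theorem1:
  fixes M :: "'w measure" and F :: "real \<Rightarrow> 'w measure"
    and W :: "real \<Rightarrow> 'w \<Rightarrow> real ^ 'm"
    and b :: "real ^ 'd \<Rightarrow> real ^ 'd" and \<sigma> :: "real ^ 'd \<Rightarrow> real ^ 'm ^ 'd"
    and bt :: "real \<Rightarrow> real ^ 'd \<Rightarrow> real ^ 'd"
    and \<sigma>t :: "real \<Rightarrow> real ^ 'd \<Rightarrow> real ^ 'm ^ 'd"
    and T\<^sub>1 T\<^sub>2 :: real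
    and X0 :: "'w \<Rightarrow> real ^ 'd"
  assumes "wiener_process M F W"
    and "\<And>\<tau>. \<tau> \<in> {0<..1} \<Longrightarrow> bt \<tau> \<in> borel_measurable borel"
    and "\<And>\<tau>. \<tau> \<in> {0<..1} \<Longrightarrow> \<sigma>t \<tau> \<in> borel_measurable borel"
    and "\<And>\<tau>. \<tau> \<in> {0<..1} \<Longrightarrow> linear_growth (bt \<tau>)"
    and "\<And>\<tau>. \<tau> \<in> {0<..1} \<Longrightarrow> linear_growth (\<sigma>t \<tau>)"
    and "\<And>x. ((\<lambda>\<tau>. bt \<tau> x) \<longlongrightarrow> b x) (at_right 0)"
    and "\<And>x. ((\<lambda>\<tau>. \<sigma>t \<tau> x) \<longlongrightarrow> \<sigma> x) (at_right 0)"
    and "T\<^sub>1 > 0" and "T\<^sub>2 > 0"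
    and "\<And>x \<tau>. \<tau> \<in> {0<..1} \<Longrightarrow>
      2 * (x \<bullet> bt \<tau> x) + (norm (\<sigma>t \<tau> x))\<^sup>2 + \<tau> * (norm (bt \<tau> x))\<^sup>2 \<le> T\<^sub>1 - T\<^sub>2 * (norm x)\<^sup>2"
    and "X0 \<in> borel_measurable (F 0)"
    and "integrable M (\<lambda>\<omega>. (norm (X0 \<omega>))\<^sup>2)"
  defines "Z \<equiv> tamed_euler_maruyama bt \<sigma>t W X0"
  shows "\<exists>\<tau>_max \<in> {0<..1}. \<forall>\<tau> \<in> {0<..\<tau>_max}. \<forall>n \<ge> 1.
    AE \<omega> in M.
      real_cond_exp M (F (real (n - 1) * \<tau>)) (\<lambda>\<omega>. (norm (Z \<tau> n \<omega>))\<^sup>2) \<omega>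
        \<le> (1 - T\<^sub>2 * \<tau>) * (norm (Z \<tau> (n - 1) \<omega>))\<^sup>2 + T\<^sub>1 * \<tau>"
proof -
  interpret wiener_process M F W by fact
  have estimate: "AE \<omega> in M. real_cond_exp M (F (real k * \<tau>)) (\<lambda>\<omega>. (norm (Z \<tau> (Suc k) \<omega>))\<^sup>2) \<omega>
      \<le> (1 - T\<^sub>2 * \<tau>) * (norm (Z \<tau> k \<omega>))\<^sup>2 + T\<^sub>1 * \<tau>"
    if \<tau>: "\<tau> \<in> {0<..1}" for \<tau> k
  proof -
    have pos: "0 < \<tau>" using \<tau> by simp
    \<comment> \<open>The term \<open>\<tau> |b\<^sub>\<tau>|\<^sup>2\<close> of the hypothesis is what the square of the drift step contributes, so the
      two sides match for every \<open>\<tau>\<close> and not only up to terms of higher order.\<close>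
    have drift: "(norm (x + \<tau> *\<^sub>R bt \<tau> x))\<^sup>2 + \<tau> * (norm (\<sigma>t \<tau> x))\<^sup>2
        \<le> (1 - T\<^sub>2 * \<tau>) * (norm x)\<^sup>2 + T\<^sub>1 * \<tau>" for x
    proof -
      have "(norm (x + \<tau> *\<^sub>R bt \<tau> x))\<^sup>2 + \<tau> * (norm (\<sigma>t \<tau> x))\<^sup>2
          = (norm x)\<^sup>2 + \<tau> * (2 * (x \<bullet> bt \<tau> x) + (norm (\<sigma>t \<tau> x))\<^sup>2 + \<tau> * (norm (bt \<tau> x))\<^sup>2)"
        by (simp add: power2_norm_eq_inner inner_add_left inner_add_right inner_commute algebra_simps)
      also have "\<dots> \<le> (norm x)\<^sup>2 + \<tau> * (T\<^sub>1 - T\<^sub>2 * (norm x)\<^sup>2)"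
        using assms(10)[OF \<tau>, of x] pos by (intro add_left_mono mult_left_mono) auto
      finally show ?thesis by (simp add: algebra_simps)
    qed
    show ?thesis
      using tamed_euler_maruyama_adapted_square_integrable(2)
        [where bt = bt and \<sigma>t = \<sigma>t and \<tau> = \<tau> and ?X0.0 = X0 and n = k, OF pos assms(2)[OF \<tau>] assms(4)[OF \<tau>]
          assms(3)[OF \<tau>] assms(5)[OF \<tau>] assms(11,12)]
      unfolding Z_def by eventually_elim (simp only: drift)
  qed
  show ?thesis
  proof (intro bexI[of _ 1] ballI allI impI)
    fix \<tau> :: real and n :: nat
    assume "\<tau> \<in> {0<..1}" "1 \<le> n"
    then show "AE \<omega> in M. real_cond_exp M (F (real (n - 1) * \<tau>)) (\<lambda>\<omega>. (norm (Z \<tau> n \<omega>))\<^sup>2) \<omega>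
        \<le> (1 - T\<^sub>2 * \<tau>) * (norm (Z \<tau> (n - 1) \<omega>))\<^sup>2 + T\<^sub>1 * \<tau>"
      using estimate[of \<tau> "n - 1"] by simp
  qed simp
qed

end
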